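(* Let $\binom{2n}{n}=\frac{(2n)!}{(n!)^2}$, let $H_n=1+\frac12+\dots+\frac1n$ with $H_0=0$, and let $\operatorname{Li}_2(x)=\sum_{n=1}^\infty \frac{x^n}{n^2}$ for $|x|\le 1$. Part 1. For complex $z$ with $|z|<1$ such that $t=\frac{z}{1+z}$ satisfies $|t|\le 1$, $$\sum_{n=0}^{\infty}\binom{2n}{n}^{-1}H_n(-1)^n4^nz^n=(1-t)\left[\sqrt{t}\,\log\frac{1-\sqrt t}{1+\sqrt t}\left(1+\frac14\log\frac{1-t}{4}\right)-\frac{\sqrt t}{2}\left(\operatorname{Li}_2\!\left(\frac{1+\sqrt t}{2}\right)-\operatorname{Li}_2\!\left(\frac{1-\sqrt t}{2}\right)\right)\right],$$ and this function has Taylor expansion $-2z+4z^2-\frac{88}{15}z^3+\frac{160}{21}z^4-\frac{8768}{945}z^5+\dots$. Part 2. For complex $z$ with $|z|<1$ such that $t=\frac{z}{1-z}$ satisfies $|t|\le 1$, $$\sum_{n=0}^{\infty}\binom{2n}{n}^{-1}H_n4^nz^n=(1+t)\left[\left(2+\frac12\log\frac{1+t}{4}\right)\sqrt t\,\arctan\sqrt t-\frac{\sqrt{-t}}{2}\left(\operatorname{Li}_2\!\left(\frac{1+\sqrt{-t}}{2}\right)-\operatorname{Li}_2\!\left(\frac{1-\sqrt{-t}}{2}\right)\right)\right],$$ and this function has Taylor expansion $2z+4z^2+\frac{88}{15}z^3+\frac{160}{21}z^4+\frac{8768}{945}z^5+\dots$.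
   Context: Logarithms $\log$ are principal branches. The expressions $\sqrt t\log\frac{1-\sqrt t}{1+\sqrt t}$, $\sqrt t\arctan\sqrt t$, and $\sqrt{s}\big(\operatorname{Li}_2(\frac{1+\sqrt s}{2})-\operatorname{Li}_2(\frac{1-\sqrt s}{2})\big)$ are even functions of the chosen square root, so they do not depend on the choice of square root; e.g. $\sqrt t\arctan\sqrt t=\sum_{n\ge1}\frac{(-1)^{n-1}t^n}{2n-1}$, and for $t\ge0$ one may take $\sqrt{-t}=i\sqrt t$. *)

theory Defs
  imports "HOL-Complex_Analysis.Complex_Analysis"
begin

text \<open>The dilogarithm is only meaningful here for \<open>norm x \<le> 1\<close>, where its series converges.\<close>

definition Li2 :: "complex \<Rightarrow> complex" where
  "Li2 x = (\<Sum>n. x ^ Suc n / of_nat (Suc n) ^ 2)"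

text \<open>
  Both closed forms take the square root \<open>sq\<close> as a parameter, so that they can be considered for an
  arbitrary (not necessarily continuous) choice of square roots.
\<close>

definition closed_form1 :: "(complex \<Rightarrow> complex) \<Rightarrow> complex \<Rightarrow> complex" where
  "closed_form1 sq z =
    (let t = z / (1 + z) in
      (1 - t) *
      (sq t * ln ((1 - sq t) / (1 + sq t)) * (1 + 1 / 4 * ln ((1 - t) / 4))
       - sq t / 2 * (Li2 ((1 + sq t) / 2) - Li2 ((1 - sq t) / 2))))"

definition closed_form2 :: "(complex \<Rightarrow> complex) \<Rightarrow> complex \<Rightarrow> complex" where
  "closed_form2 sq z =
    (let t = z / (1 - z) in
      (1 + t) *
      ((2 + 1 / 2 * ln ((1 + t) / 4)) * (sq t * Arctan (sq t))
       - sq (- t) / 2 * (Li2 ((1 + sq (- t)) / 2) - Li2 ((1 - sq (- t)) / 2))))"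

end

theory Submission
  imports Defs
begin

text \<open>
  The coefficients \<open>b\<^sub>n = (-4)\<^sup>n / binom(2n, n)\<close> satisfy a first-order recurrence, so the generating
  functions of \<open>b\<^sub>n\<close> and of \<open>b\<^sub>n H\<^sub>n\<close> solve linear first-order differential equations with the same
  homogeneous part, the former being the inhomogeneity of the latter. With the square root \<open>s\<close> of
  \<open>t = z / (1 + z)\<close> as parameter, an integrating factor turns these equations into elementary
  integrations, which produce the logarithms and the dilogarithms. All \<open>s\<close> with \<open>|s| \<le> 1\<close> and
  \<open>Re s\<^sup>2 < 1/2\<close> are covered, including both square roots and the boundary \<open>|t| = 1\<close>, because this set
  is star-shaped around \<open>0\<close> and both sides are holomorphic near each of its points. The second
  formula is the first one at \<open>-z\<close>.
\<close>

section \<open>The power series\<close>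

definition inv_central_binom :: "nat \<Rightarrow> complex" where
  "inv_central_binom n = (-4) ^ n / of_nat (2 * n choose n)"

definition inv_central_binom_fps :: "complex fps" where
  "inv_central_binom_fps = Abs_fps inv_central_binom"

definition harm_inv_central_binom_fps :: "complex fps" where
  "harm_inv_central_binom_fps = Abs_fps (\<lambda>n. inv_central_binom n * harm n)"

lemma inv_central_binom_0 [simp]: "inv_central_binom 0 = 1"
  by (simp add: inv_central_binom_def)

text \<open>Consecutive central binomial coefficients have ratio
  \<open>2 * (2 * n + 1) / (n + 1)\<close>. The recurrence is kept free of denominators because the
  factors \<open>2 * n + 1\<close> and \<open>2 * n + 2\<close> then become differential operators
  acting on the generating function.\<close>

lemma inv_central_binom_Suc:
  "(2 * of_nat n + 1) * inv_central_binom (Suc n) = - (2 * of_nat n + 2) * inv_central_binom n"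
proof -
  have nz: "2 * of_nat n + 1 \<noteq> (0::complex)" "of_nat n + 1 \<noteq> (0::complex)"
    using of_nat_neq_0[of "2 * n", where 'a = complex] of_nat_neq_0[of n, where 'a = complex]
    by (simp_all add: add.commute)
  have "2 + of_nat n * 4 = 2 * (2 * of_nat n + (1::complex))" by simp
  hence nz': "2 + of_nat n * 4 \<noteq> (0::complex)" using nz(1) by (metis mult_eq_0_iff zero_neq_numeral)
  have fact_nz: "fact m \<noteq> (0::complex)" for m by simp
  have eq: "of_nat (2 * m choose m) = (fact (2 * m) / (fact m * fact m) :: complex)" for m
    by (subst binomial_fact) auto
  have rat: "of_nat (2 * Suc n choose Suc n)
      = (2 * (2 * of_nat n + 1) / (of_nat n + 1) * of_nat (2 * n choose n) :: complex)"
    unfolding eq using nz nz' fact_nz[of n] by (simp add: divide_simps) (simp add: algebra_simps)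
  have "of_nat (2 * n choose n) \<noteq> (0::complex)"
    by simp
  thus ?thesis
    unfolding inv_central_binom_def rat using nz nz' by (simp add: divide_simps) (simp add: algebra_simps)
qed

section \<open>Growth of the coefficients and radius of convergence\<close>

lemma norm_harm_le: "norm (harm n :: complex) \<le> real n"
proof -
  have "norm (harm n :: complex) \<le> (\<Sum>k=1..n. 1)"
    unfolding harm_def by (rule sum_norm_le) (auto simp: norm_divide divide_simps)
  thus ?thesis by simp
qed

text \<open>The library bound \<open>4 ^ n / (2 * n)\<close> for the central binomial coefficient
  requires \<open>n > 0\<close>; the extra \<open>+ 1\<close> covers \<open>n = 0\<close>.\<close>

lemma norm_inv_central_binom_le: "norm (inv_central_binom n) \<le> 2 * real n + 1"
proof (cases "n = 0")
  case False
  hence "4 ^ n / (2 * real n) \<le> real (2 * n choose n)"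
    by (intro central_binomial_lower_bound) auto
  moreover have "real (2 * n choose n) > 0" by simp
  ultimately have "4 ^ n / real (2 * n choose n) \<le> 2 * real n"
    using False by (simp add: field_simps)
  thus ?thesis by (simp add: inv_central_binom_def norm_divide norm_power)
qed auto

text \<open>Comparison with a polynomial times a geometric sequence. A quadratic bound is enough for
  both series, since the harmonic factor adds at most one power of \<open>n\<close>.\<close>

lemma fps_conv_radius_ge_1:
  assumes "\<And>n. norm (fps_nth F n :: complex) \<le> 3 * (real n + 1) ^ 2"
  shows "fps_conv_radius F \<ge> 1"
proof -
  have "conv_radius (\<lambda>n. 3 * (real n + 1) ^ 2) = 1"
    by (rule conv_radius_ratio_limit_nonzero[where c = 1]) (simp_all, real_asymp)
  hence sm: "summable (\<lambda>n. 3 * (real n + 1) ^ 2 * r ^ n)" if "0 < r" "r < 1" for r :: real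
    using that by (intro summable_in_conv_radius) simp
  show ?thesis
    unfolding fps_conv_radius_def
  proof (rule conv_radius_geI_ex')
    fix r :: real assume r: "0 < r" "ereal r < 1"
    show "summable (\<lambda>n. fps_nth F n * of_real r ^ n)"
      using r assms by (intro summable_comparison_test'[OF sm[of r]])
        (auto simp: norm_mult norm_power intro!: mult_right_mono)
  qed
qed

lemma fps_conv_radius_inv_central_binom: "fps_conv_radius inv_central_binom_fps \<ge> 1"
proof (rule fps_conv_radius_ge_1)
  fix n
  have "2 * real n + 1 \<le> 3 * (real n + 1) ^ 2" by (simp add: power2_eq_square algebra_simps)
  thus "norm (fps_nth inv_central_binom_fps n) \<le> 3 * (real n + 1) ^ 2"
    using norm_inv_central_binom_le[of n] by (simp add: inv_central_binom_fps_def)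
qed

lemma fps_conv_radius_harm_inv_central_binom: "fps_conv_radius harm_inv_central_binom_fps \<ge> 1"
proof (rule fps_conv_radius_ge_1)
  fix n
  have "norm (inv_central_binom n * harm n) \<le> (2 * real n + 1) * real n"
    unfolding norm_mult by (intro mult_mono norm_inv_central_binom_le norm_harm_le) auto
  also have "\<dots> \<le> 3 * (real n + 1) ^ 2" by (simp add: power2_eq_square algebra_simps)
  finally show "norm (fps_nth harm_inv_central_binom_fps n) \<le> 3 * (real n + 1) ^ 2"
    by (simp add: harm_inv_central_binom_fps_def)
qed

section \<open>Differential equations for the generating functions\<close>

text \<open>The coefficient of index \<open>n\<close> on the left is \<open>2 * n + 1\<close> times
  the current plus \<open>2 * n + 2\<close> times the previous coefficient of \<open>M\<close>, so
  the recurrence cancels everything except the constant term. Shifting by one index keeps the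
  integrating factor free of a pole at \<open>s = 0\<close>.\<close>

lemma fps_shift_inv_central_binom_ode:
  defines "M \<equiv> fps_shift 1 inv_central_binom_fps"
  shows "2 * (fps_X * fps_deriv M) + 2 * (fps_X * (fps_X * fps_deriv M)) + M + 4 * (fps_X * M) = - 2"
proof (rule fps_ext)
  fix n
  show "fps_nth (2 * (fps_X * fps_deriv M) + 2 * (fps_X * (fps_X * fps_deriv M)) + M + 4 * (fps_X * M)) n
      = fps_nth (- 2) n"
  proof (cases n)
    case 0
    thus ?thesis using inv_central_binom_Suc[of 0]
      by (simp add: M_def inv_central_binom_fps_def fps_numeral_nth)
  next
    case (Suc m)
    \<comment> \<open>The double factor \<open>fps_X\<close> shifts by two indices, so index 1 has
      to be separated from the larger ones.\<close>
    show ?thesis using inv_central_binom_Suc[of n] unfolding Suc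
      by (cases m) (simp_all add: M_def inv_central_binom_fps_def fps_numeral_nth numeral_fps_const algebra_simps)
  qed
qed

text \<open>Same operator as before. The increment \<open>1 / (n + 1)\<close> of the harmonic
  numbers, multiplied by \<open>2 * n + 2\<close>, leaves the constant 2, and this is the source of
  the right-hand side.\<close>

lemma fps_shift_harm_inv_central_binom_ode:
  defines "K \<equiv> fps_shift 1 harm_inv_central_binom_fps"
  shows "2 * (fps_X * fps_deriv K) + 2 * (fps_X * (fps_X * fps_deriv K)) + K + 4 * (fps_X * K)
           = - 2 * inv_central_binom_fps"
proof (rule fps_ext)
  fix n
  have rec: "(2 * of_nat n + 1) * (inv_central_binom (Suc n) * harm (Suc n))
    + (2 * of_nat n + 2) * (inv_central_binom n * harm n) = - 2 * inv_central_binom n" for n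
  proof -
    have "of_nat n + 1 \<noteq> (0::complex)"
      using of_nat_neq_0[of n, where 'a = complex] by (simp add: add.commute)
    hence *: "(2 * of_nat n + 2) * (harm n + inverse (of_nat n + 1)) = (2 * of_nat n + 2) * harm n + (2::complex)"
      by (simp add: field_simps)
    have **: "(2 * of_nat n + 1) * (inv_central_binom (Suc n) * harm (Suc n))
      = - inv_central_binom n * ((2 * of_nat n + 2) * (harm n + inverse (of_nat n + 1)))"
      using inv_central_binom_Suc[of n] by (simp add: harm_Suc add.commute) algebra
    show ?thesis unfolding ** * by (simp add: algebra_simps)
  qed
  show "fps_nth (2 * (fps_X * fps_deriv K) + 2 * (fps_X * (fps_X * fps_deriv K)) + K + 4 * (fps_X * K)) n
      = fps_nth (- 2 * inv_central_binom_fps) n"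
  proof (cases n)
    case 0
    thus ?thesis using rec[of 0]
      by (simp add: K_def inv_central_binom_fps_def harm_inv_central_binom_fps_def numeral_fps_const
          harm_def)
  next
    case (Suc m)
    show ?thesis using rec[of n] unfolding Suc
      by (cases m) (simp_all add: K_def inv_central_binom_fps_def harm_inv_central_binom_fps_def numeral_fps_const algebra_simps)
  qed
qed

text \<open>
  The factor \<open>s / (1 - s\<^sup>2)\<^sup>2\<close> is an integrating factor for the differential equation
  after the substitution \<open>z = s\<^sup>2 / (1 - s\<^sup>2)\<close>.
\<close>

lemma has_field_derivative_integrating_factor:
  fixes K E :: "complex fps"
  assumes K: "fps_conv_radius K \<ge> 1" and E: "fps_conv_radius E \<ge> 1"
    and ode: "2 * (fps_X * fps_deriv K) + 2 * (fps_X * (fps_X * fps_deriv K)) + K + 4 * (fps_X * K)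
                = - 2 * E"
    and s: "s\<^sup>2 \<noteq> 1" and z: "norm (s\<^sup>2 / (1 - s\<^sup>2)) < 1"
  shows "((\<lambda>s. s * eval_fps K (s\<^sup>2 / (1 - s\<^sup>2)) / (1 - s\<^sup>2)\<^sup>2) has_field_derivative
           - 2 * eval_fps E (s\<^sup>2 / (1 - s\<^sup>2)) / (1 - s\<^sup>2)\<^sup>2) (at s)"
proof -
  define u where "u = 1 - s\<^sup>2"
  define z where "z = s\<^sup>2 / (1 - s\<^sup>2)"
  define k k' e where "k = eval_fps K z" and "k' = eval_fps (fps_deriv K) z" and "e = eval_fps E z"
  have u: "u \<noteq> 0" "s\<^sup>2 = 1 - u" using s by (auto simp: u_def)
  have zu: "z * u = 1 - u" using s by (simp add: z_def u_def)
  have z1: "ereal (norm z) < 1" using z by (simp add: z_def)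
  have le: "1 \<le> fps_conv_radius (fps_deriv K)"
    using K fps_conv_radius_deriv order_trans by blast
  have K': "ereal (norm z) < fps_conv_radius K" "ereal (norm z) < fps_conv_radius (fps_deriv K)"
    "ereal (norm z) < fps_conv_radius E"
    using K E le by (blast intro: less_le_trans[OF z1])+
  have mult: "ereal (norm z) < fps_conv_radius (F * G)"
    if "ereal (norm z) < fps_conv_radius F" "ereal (norm z) < fps_conv_radius G" for F G :: "complex fps"
    using that fps_conv_radius_mult[of F G] by (meson less_le_trans min_less_iff_conj)
  have add: "ereal (norm z) < fps_conv_radius (F + G)"
    if "ereal (norm z) < fps_conv_radius F" "ereal (norm z) < fps_conv_radius G" for F G :: "complex fps"
    using that fps_conv_radius_add[of F G] by (meson less_le_trans min_less_iff_conj)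
  have "eval_fps (2 * (fps_X * fps_deriv K) + 2 * (fps_X * (fps_X * fps_deriv K)) + K + 4 * (fps_X * K)) z
    = eval_fps (- (2 * E)) z" using ode by simp
  hence ode': "2 * (z * k') + 2 * (z * (z * k')) + k + 4 * (z * k) = - 2 * e"
    using K' by (simp add: eval_fps_add eval_fps_mult eval_fps_minus mult add k_def k'_def e_def)
  have dz: "((\<lambda>s. s\<^sup>2 / (1 - s\<^sup>2)) has_field_derivative (2 * s / u\<^sup>2)) (at s)"
    using s by (auto intro!: derivative_eq_intros simp: u_def) (simp add: field_simps power2_eq_square)
  have dK: "((\<lambda>s. eval_fps K (s\<^sup>2 / (1 - s\<^sup>2))) has_field_derivative (k' * (2 * s / u\<^sup>2))) (at s)"
    using DERIV_chain2[OF has_field_derivative_eval_fps dz] K' by (simp add: z_def k'_def)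
  have du: "((\<lambda>s. (1 - s\<^sup>2)\<^sup>2) has_field_derivative 2 * u * (- 2 * s)) (at s)"
    by (auto intro!: derivative_eq_intros simp: u_def)
  have "((\<lambda>s. s * eval_fps K (s\<^sup>2 / (1 - s\<^sup>2)) / (1 - s\<^sup>2)\<^sup>2) has_field_derivative
     ((1 * k + k' * (2 * s / u\<^sup>2) * s) * u\<^sup>2 - s * k * (2 * u * (- 2 * s))) / (u\<^sup>2 * u\<^sup>2)) (at s)"
    using DERIV_divide[OF DERIV_mult[OF DERIV_ident dK] du] u(1) by (simp only: u_def k_def z_def) simp
  also have "((1 * k + k' * (2 * s / u\<^sup>2) * s) * u\<^sup>2 - s * k * (2 * u * (- 2 * s))) / (u\<^sup>2 * u\<^sup>2)
     = (k * u\<^sup>2 + 2 * k' * s\<^sup>2 + 4 * k * u * s\<^sup>2) / (u\<^sup>2 * u\<^sup>2)"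
    using u(1) by (simp add: field_simps power2_eq_square)
  \<comment> \<open>This is the differential equation multiplied by the square of \<open>u\<close>,
    simplified by \<open>z * u = 1 - u\<close>.\<close>
  also have "k * u\<^sup>2 + 2 * k' * s\<^sup>2 + 4 * k * u * s\<^sup>2 = (- 2 * e) * u\<^sup>2"
    unfolding ode'[symmetric] u(2) using zu by algebra
  also have "(- 2 * e) * u\<^sup>2 / (u\<^sup>2 * u\<^sup>2) = - 2 * e / u\<^sup>2"
    by (rule nonzero_mult_divide_mult_cancel_right) (use u(1) in simp)
  finally show ?thesis by (simp add: u_def e_def z_def)
qed

section \<open>The dilogarithm\<close>

lemma Ln_one_minus_sums:
  assumes "norm x < 1"
  shows "(\<lambda>n. x ^ Suc n / of_nat (Suc n)) sums (- Ln (1 - x))"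
proof -
  have "(\<lambda>n. - (x ^ n / of_nat n)) sums Ln (1 - x)"
    using Ln_series'[of "- x"] assms by simp
  hence "(\<lambda>n. x ^ n / of_nat n) sums (- Ln (1 - x))"
    using sums_minus by fastforce
  thus ?thesis by (subst sums_Suc_iff) simp
qed

text \<open>Termwise differentiation turns the series into the logarithm series divided by
  \<open>x\<close>. At \<open>x = 0\<close> the quotient would evaluate to 0, whereas the derivative
  of the dilogarithm is 1 there.\<close>

lemma has_field_derivative_Li2:
  assumes x: "norm x < 1" "x \<noteq> 0"
  shows "(Li2 has_field_derivative (- Ln (1 - x) / x)) (at x)"
proof -
  \<comment> \<open>Since \<open>1 / 0 = 0\<close>, the coefficient \<open>c 0\<close> vanishes and
    the series agrees with that of \<open>Li2\<close>, which starts at exponent 1.\<close>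
  define c :: "nat \<Rightarrow> complex" where "c n = 1 / of_nat n ^ 2" for n
  have sm: "summable (\<lambda>n. c n * y ^ n)" if "norm y < 1" for y
  proof (rule summable_comparison_test'[of "\<lambda>n. norm y ^ n" 0])
    show "summable (\<lambda>n. norm y ^ n)" using that by (simp add: summable_geometric)
    fix n :: nat
    have "norm (c n) \<le> 1" by (cases "n = 0") (auto simp: c_def norm_divide norm_power divide_simps)
    thus "norm (c n * y ^ n) \<le> norm y ^ n"
      by (simp add: norm_mult norm_power mult_left_le_one_le)
  qed
  have "((\<lambda>x. \<Sum>n. c n * x ^ n) has_field_derivative (\<Sum>n. diffs c n * x ^ n)) (at x)"
    using x sm by (intro termdiffs_strong'[of 1]) auto
  also have "(\<lambda>n. diffs c n * x ^ n) = (\<lambda>n. x ^ Suc n / of_nat (Suc n) / x)"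
    using x(2) of_nat_neq_0[where 'a = complex]
    by (auto simp: diffs_def c_def power2_eq_square divide_simps simp del: of_nat_Suc)
  also have "(\<Sum>n. x ^ Suc n / of_nat (Suc n) / x) = - Ln (1 - x) / x"
    by (rule sums_unique[symmetric, OF sums_divide[OF Ln_one_minus_sums[OF x(1)]]])
  finally have *: "((\<lambda>x. \<Sum>n. c n * x ^ n) has_field_derivative (- Ln (1 - x) / x)) (at x)" .
  have eq: "(\<Sum>n. c n * y ^ n) = Li2 y" if "y \<in> ball 0 1" for y
    using suminf_split_head[OF sm[of y]] that by (simp add: c_def Li2_def)
  show ?thesis
    using * by (rule has_field_derivative_transform_within_open[of _ _ _ "ball 0 1"]) (use x eq in auto)
qed

section \<open>Logarithms\<close>

text \<open>Both arguments lie strictly between \<open>- pi / 2\<close> and \<open>pi / 2\<close>,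
  so their sum stays in the range of the principal branch.\<close>

lemma Ln_times_right_half_plane:
  assumes "Re w > 0" "Re z > 0"
  shows "Ln (w * z) = Ln w + Ln z"
  using Re_Ln_pos_lt_imp[OF assms(1)] Re_Ln_pos_lt_imp[OF assms(2)] assms
  by (intro Ln_times_simple) auto

lemma Ln_divide_right_half_plane:
  assumes "Re w > 0" "Re z > 0"
  shows "Ln (w / z) = Ln w - Ln z"
proof -
  have "Re (inverse z) > 0" using assms(2)
    unfolding inverse_complex.sel by (intro divide_pos_pos add_pos_nonneg) auto
  moreover have "Ln (inverse z) = - Ln z"
    using assms(2) by (intro Ln_inverse) (auto simp: complex_nonpos_Reals_iff)
  ultimately show ?thesis
    using Ln_times_right_half_plane[of w "inverse z"] assms by (simp add: field_simps)
qed

lemma has_field_derivative_Ln_half: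
  shows "Re (1 - s) > 0 \<Longrightarrow> ((\<lambda>s. Ln ((1 - s) / 2)) has_field_derivative - 1 / (1 - s)) (at s)"
    and "Re (1 + s) > 0 \<Longrightarrow> ((\<lambda>s. Ln ((1 + s) / 2)) has_field_derivative 1 / (1 + s)) (at s)"
proof -
  have *: "((\<lambda>s. Ln (g s / 2)) has_field_derivative d / g s) (at s)"
    if "(g has_field_derivative d) (at s)" "Re (g s) > 0" for g :: "complex \<Rightarrow> complex" and d
  proof (rule DERIV_cong)
    show "((\<lambda>s. Ln (g s / 2)) has_field_derivative 1 / (g s / 2) * (d / 2)) (at s)"
      using that by (auto intro!: derivative_eq_intros simp: complex_nonpos_Reals_iff)
  qed (use that in auto)
  show "Re (1 - s) > 0 \<Longrightarrow> ((\<lambda>s. Ln ((1 - s) / 2)) has_field_derivative - 1 / (1 - s)) (at s)"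
    "Re (1 + s) > 0 \<Longrightarrow> ((\<lambda>s. Ln ((1 + s) / 2)) has_field_derivative 1 / (1 + s)) (at s)"
    by (rule *; (auto intro!: derivative_eq_intros; fail)?; simp)+
qed

text \<open>The closed unit disc touches the line \<open>Re s = 1\<close> only at the point
  1.\<close>

lemma Re_less_one_if_norm_le_one:
  assumes "norm (s::complex) \<le> 1" "s \<noteq> 1"
  shows "Re s < 1"
proof (rule ccontr)
  assume "\<not> Re s < 1"
  hence "Re s = 1" using complex_Re_le_cmod[of s] assms(1) by linarith
  moreover have "(Re s)\<^sup>2 + (Im s)\<^sup>2 \<le> 1" using assms(1)
    by (metis cmod_power2 norm_ge_zero one_power2 power_mono)
  ultimately show False using assms(2) by (auto simp: complex_eq_iff)
qed

section \<open>The closed form along the square root parameter\<close>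

text \<open>With \<open>t = s^2\<close> and \<open>z = t / (1 - t)\<close>, the first condition says
  \<open>norm t \<le> 1\<close>. The second is equivalent to \<open>norm t < norm (1 - t)\<close>,
  that is, to \<open>norm z < 1\<close>.\<close>

definition param_domain :: "complex set" where
  "param_domain = {s. norm s \<le> 1 \<and> Re (s\<^sup>2) < 1 / 2}"

text \<open>On the closed unit disc only \<open>s = 1\<close> and \<open>s = -1\<close> could cause
  trouble, and both have square 1, which the bound on the real part excludes. Hence all logarithms
  avoid their cuts and the dilogarithm arguments are strictly inside the unit disc even when
  \<open>norm s = 1\<close>.\<close>

lemma param_domainD:
  assumes "s \<in> param_domain"
  shows "s\<^sup>2 \<noteq> 1" "norm (s\<^sup>2 / (1 - s\<^sup>2)) < 1" "Re (1 + s) > 0" "Re (1 - s) > 0"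
    "norm ((1 + s) / 2) < 1" "norm ((1 - s) / 2) < 1"
proof -
  have s: "norm s \<le> 1" "Re (s\<^sup>2) < 1 / 2" using assms by (auto simp: param_domain_def)
  show s1: "s\<^sup>2 \<noteq> 1" using s by auto
  hence "s \<noteq> 1" "- s \<noteq> 1" by (auto, metis add.inverse_inverse power2_minus one_power2)
  thus re: "Re (1 + s) > 0" "Re (1 - s) > 0"
    using Re_less_one_if_norm_le_one[of s] Re_less_one_if_norm_le_one[of "- s"] s by auto
  have lt: "norm a < norm b" if "Re a < Re b" "Re a > - Re b" "Im a = - Im b \<or> Im a = Im b" for a b :: complex
  proof -
    have "0 < (Re b - Re a) * (Re b + Re a)" using that by (intro mult_pos_pos) auto
    hence "(norm a)\<^sup>2 < (norm b)\<^sup>2" using that(3) unfolding cmod_power2 by (auto simp: power2_eq_square algebra_simps)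
    thus ?thesis by (rule power_less_imp_less_base) simp
  qed
  have "norm (s\<^sup>2) < norm (1 - s\<^sup>2)" using s(2) by (intro lt) auto
  thus "norm (s\<^sup>2 / (1 - s\<^sup>2)) < 1" using s1 by (simp add: norm_divide)
  have n2: "(Re s)\<^sup>2 + (Im s)\<^sup>2 \<le> 1" using s(1)
    by (metis cmod_power2 norm_ge_zero one_power2 power_mono)
  \<comment> \<open>The squares are \<open>1 + norm s ^ 2\<close> plus or minus
    \<open>2 * Re s\<close>, and \<open>Re s\<close> lies strictly between -1 and 1.\<close>
  have "norm (1 + s) ^ 2 < 2 ^ 2" "norm (1 - s) ^ 2 < 2 ^ 2"
    using n2 re unfolding cmod_power2 by (auto simp: power2_eq_square algebra_simps)
  hence "norm (1 + s) < 2" "norm (1 - s) < 2"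
    by (metis power_less_imp_less_base zero_le_numeral)+
  thus "norm ((1 + s) / 2) < 1" "norm ((1 - s) / 2) < 1" by (auto simp: norm_divide)
qed

text \<open>Both \<open>(1 - s) / 2\<close> and \<open>(1 + s) / 2\<close> lie in the right
  half-plane, so no branch correction occurs. The halves are used because exactly these logarithms
  arise when the dilogarithms are differentiated.\<close>

lemma Ln_param_domain:
  assumes "s \<in> param_domain"
  shows "Ln ((1 - s) / (1 + s)) = Ln ((1 - s) / 2) - Ln ((1 + s) / 2)"
    and "Ln ((1 - s\<^sup>2) / 4) = Ln ((1 - s) / 2) + Ln ((1 + s) / 2)"
proof -
  have re: "Re ((1 - s) / 2) > 0" "Re ((1 + s) / 2) > 0" using param_domainD[OF assms] by auto
  have "a / b = (a / 2) / (b / 2)" for a b :: complex by simp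
  hence "(1 - s) / (1 + s) = ((1 - s) / 2) / ((1 + s) / 2)" .
  thus "Ln ((1 - s) / (1 + s)) = Ln ((1 - s) / 2) - Ln ((1 + s) / 2)"
    using Ln_divide_right_half_plane[OF re] by simp
  have "(1 - s\<^sup>2) / 4 = ((1 - s) / 2) * ((1 + s) / 2)"
    by (simp add: power2_eq_square algebra_simps)
  thus "Ln ((1 - s\<^sup>2) / 4) = Ln ((1 - s) / 2) + Ln ((1 + s) / 2)"
    using Ln_times_right_half_plane[OF re] by (simp only:)
qed

text \<open>The segment from 0 to \<open>s\<close> stays in the domain, and along it
  \<open>f - g\<close> has derivative zero.\<close>

lemma eqI_derivative_param_domain:
  assumes "\<And>s. s \<in> param_domain \<Longrightarrow> (f has_field_derivative D s) (at s)"
    and "\<And>s. s \<in> param_domain \<Longrightarrow> (g has_field_derivative D s) (at s)"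
    and "f 0 = g 0" and s: "s \<in> param_domain"
  shows "f s = g s"
proof -
  have seg: "x \<in> param_domain" if x: "x \<in> closed_segment 0 s" for x
  proof -
    obtain u where u: "x = of_real u * s" "0 \<le> u" "u \<le> 1"
      using x by (auto simp: closed_segment_def scaleR_conv_of_real)
    have u2: "0 \<le> u\<^sup>2" "u\<^sup>2 \<le> 1" using u by (auto simp: power_le_one)
    have "Re (x\<^sup>2) = u\<^sup>2 * Re (s\<^sup>2)"
      unfolding u(1) power_mult_distrib by (simp flip: of_real_power)
    also have "\<dots> < 1 / 2"
    proof (cases "Re (s\<^sup>2) \<ge> 0")
      case True
      hence "u\<^sup>2 * Re (s\<^sup>2) \<le> 1 * Re (s\<^sup>2)" using u2 by (intro mult_right_mono) auto
      thus ?thesis using s by (auto simp: param_domain_def)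
    next
      case False
      hence "u\<^sup>2 * Re (s\<^sup>2) \<le> 0" using u2 by (intro mult_nonneg_nonpos) auto
      thus ?thesis by linarith
    qed
    finally have "Re (x\<^sup>2) < 1 / 2" .
    moreover have "norm x \<le> 1"
      using u s by (auto simp: param_domain_def norm_mult intro!: mult_le_one)
    ultimately show ?thesis by (simp add: param_domain_def)
  qed
  have "\<exists>c. \<forall>x\<in>closed_segment 0 s. f x - g x = c"
  proof (rule has_field_derivative_zero_constant)
    fix x assume "x \<in> closed_segment 0 s"
    hence "((\<lambda>x. f x - g x) has_field_derivative (D x - D x)) (at x)"
      using assms(1,2) seg by (intro DERIV_diff) auto
    thus "((\<lambda>x. f x - g x) has_field_derivative 0) (at x within closed_segment 0 s)"
      by (simp add: has_field_derivative_at_within)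
  qed simp
  then obtain c where "f x - g x = c" if "x \<in> closed_segment 0 s" for x by blast
  from this[of 0] this[of s] show ?thesis using assms(3) by simp
qed

text \<open>With \<open>E = 1\<close> the integrating factor leaves a rational derivative, whose
  antiderivative follows by partial fractions. The value of the full series is then recovered from
  \<open>1 + z * M\<close>.\<close>

lemma eval_inv_central_binom_fps:
  assumes s: "s \<in> param_domain"
  shows "eval_fps inv_central_binom_fps (s\<^sup>2 / (1 - s\<^sup>2))
    = (1 - s\<^sup>2) * (1 + s / 2 * (Ln ((1 - s) / 2) - Ln ((1 + s) / 2)))"
proof -
  define M where "M = fps_shift 1 inv_central_binom_fps"
  have M: "fps_conv_radius M \<ge> 1" using fps_conv_radius_inv_central_binom by (simp add: M_def)
  have *: "s * eval_fps M (s\<^sup>2 / (1 - s\<^sup>2)) / (1 - s\<^sup>2)\<^sup>2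
    = (Ln ((1 - s) / 2) - Ln ((1 + s) / 2)) / 2 - s / (1 - s\<^sup>2)"
  proof (rule eqI_derivative_param_domain[where D = "\<lambda>s. - 2 / (1 - s\<^sup>2)\<^sup>2", OF _ _ _ s])
    fix x assume x: "x \<in> param_domain"
    note D = param_domainD[OF x]
    show "((\<lambda>s. s * eval_fps M (s\<^sup>2 / (1 - s\<^sup>2)) / (1 - s\<^sup>2)\<^sup>2) has_field_derivative
      - 2 / (1 - x\<^sup>2)\<^sup>2) (at x)"
      using has_field_derivative_integrating_factor[of M 1 x] M D fps_shift_inv_central_binom_ode
      by (simp add: M_def)
    have nz: "1 - x \<noteq> 0" "1 + x \<noteq> 0" using D(3,4) by (metis less_irrefl zero_complex.sel(1))+
    have eq: "1 - x\<^sup>2 = (1 - x) * (1 + x)" by (simp add: power2_eq_square algebra_simps)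
    have d: "((\<lambda>s. s / (1 - s\<^sup>2)) has_field_derivative
        ((1 - x\<^sup>2) - x * (- 2 * x)) / (1 - x\<^sup>2)\<^sup>2) (at x)"
      using D(1) by (auto intro!: derivative_eq_intros simp: power2_eq_square)
    have "((\<lambda>s. (Ln ((1 - s) / 2) - Ln ((1 + s) / 2)) / 2 - s / (1 - s\<^sup>2)) has_field_derivative
      (- 1 / (1 - x) - 1 / (1 + x)) / 2
        - ((1 - x\<^sup>2) - x * (- 2 * x)) / (1 - x\<^sup>2)\<^sup>2) (at x)"
      using D(3,4) by (intro DERIV_diff DERIV_cdivide has_field_derivative_Ln_half d)
    also have "(- 1 / (1 - x) - 1 / (1 + x)) / 2
        - ((1 - x\<^sup>2) - x * (- 2 * x)) / (1 - x\<^sup>2)\<^sup>2 = - 2 / (1 - x\<^sup>2)\<^sup>2"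
      unfolding eq using nz by (simp add: divide_simps) (simp add: power2_eq_square algebra_simps)
    finally show "((\<lambda>s. (Ln ((1 - s) / 2) - Ln ((1 + s) / 2)) / 2 - s / (1 - s\<^sup>2)) has_field_derivative
      - 2 / (1 - x\<^sup>2)\<^sup>2) (at x)" .
  qed auto
  define z where "z = s\<^sup>2 / (1 - s\<^sup>2)"
  define L where "L = Ln ((1 - s) / 2) - Ln ((1 + s) / 2)"
  have u: "1 - s\<^sup>2 \<noteq> 0" and z: "norm z < 1" using param_domainD[OF s] by (auto simp: z_def)
  have eq: "inv_central_binom_fps = 1 + fps_X * M"
    by (rule fps_ext) (auto simp: M_def inv_central_binom_fps_def fps_X_mult_nth)
  have rM: "ereal (norm z) < fps_conv_radius M"
    using z by (intro less_le_trans[OF _ M]) simp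
  moreover have "ereal (norm z) < fps_conv_radius (fps_X * M)"
    using rM by (intro less_le_trans[OF _ fps_conv_radius_mult]) simp
  ultimately have "eval_fps inv_central_binom_fps z = 1 + z * eval_fps M z"
    unfolding eq by (simp add: eval_fps_add eval_fps_mult)
  also have "z * eval_fps M z = s * (1 - s\<^sup>2) * (s * eval_fps M z / (1 - s\<^sup>2)\<^sup>2)"
    using u by (simp add: z_def power2_eq_square divide_simps)
  also have "s * eval_fps M z / (1 - s\<^sup>2)\<^sup>2 = L / 2 - s / (1 - s\<^sup>2)"
    using * by (simp add: z_def L_def)
  also have "1 + s * (1 - s\<^sup>2) * (L / 2 - s / (1 - s\<^sup>2)) = (1 - s\<^sup>2) * (1 + s / 2 * L)"
    using u by (simp add: field_simps power2_eq_square)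
  finally show ?thesis by (simp add: z_def L_def)
qed

text \<open>The second integration: the inhomogeneity is the series just evaluated, so its
  logarithms are integrated once more, and this gives products of logarithms and
  dilogarithms.\<close>

lemma eval_harm_inv_central_binom_fps:
  assumes s: "s \<in> param_domain"
  shows "eval_fps harm_inv_central_binom_fps (s\<^sup>2 / (1 - s\<^sup>2))
    = (1 - s\<^sup>2) * (s * Ln ((1 - s) / (1 + s)) * (1 + 1 / 4 * Ln ((1 - s\<^sup>2) / 4))
       - s / 2 * (Li2 ((1 + s) / 2) - Li2 ((1 - s) / 2)))"
proof -
  define K where "K = fps_shift 1 harm_inv_central_binom_fps"
  have K: "fps_conv_radius K \<ge> 1" using fps_conv_radius_harm_inv_central_binom by (simp add: K_def)
  define L1 L2 where "L1 = (\<lambda>s::complex. Ln ((1 - s) / 2))" and "L2 = (\<lambda>s::complex. Ln ((1 + s) / 2))"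
  \<comment> \<open>The product contains \<open>(L1^2 - L2^2) / 4\<close>. Its derivative and that
    of the dilogarithm part combine to \<open>- s * (L1 - L2) / (1 - s^2)\<close>; the remaining
    \<open>L1 - L2\<close> contributes \<open>- 2 / (1 - s^2)\<close>.\<close>
  define \<phi> where "\<phi> = (\<lambda>s. (L1 s - L2 s) * (1 + 1 / 4 * (L1 s + L2 s))
    - (Li2 ((1 + s) / 2) - Li2 ((1 - s) / 2)) / 2)"
  have *: "s * eval_fps K (s\<^sup>2 / (1 - s\<^sup>2)) / (1 - s\<^sup>2)\<^sup>2 = \<phi> s"
  proof (rule eqI_derivative_param_domain
      [where D = "\<lambda>s. - (2 + s * (L1 s - L2 s)) / (1 - s\<^sup>2)", OF _ _ _ s])
    fix x assume x: "x \<in> param_domain"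
    note D = param_domainD[OF x]
    have nz: "1 - x \<noteq> 0" "1 + x \<noteq> 0" "1 - x\<^sup>2 \<noteq> 0"
      using D(1,3,4) by (metis less_irrefl zero_complex.sel(1), metis less_irrefl zero_complex.sel(1), simp)
    have eq: "1 - x\<^sup>2 = (1 - x) * (1 + x)" by (simp add: power2_eq_square algebra_simps)
    have "- 2 * eval_fps inv_central_binom_fps (x\<^sup>2 / (1 - x\<^sup>2)) / (1 - x\<^sup>2)\<^sup>2
      = - (2 + x * (L1 x - L2 x)) / (1 - x\<^sup>2)"
      unfolding eval_inv_central_binom_fps[OF x] L1_def L2_def
      using nz(3) by (simp add: divide_simps) (simp add: power2_eq_square algebra_simps)
    thus "((\<lambda>s. s * eval_fps K (s\<^sup>2 / (1 - s\<^sup>2)) / (1 - s\<^sup>2)\<^sup>2) has_field_derivative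
      - (2 + x * (L1 x - L2 x)) / (1 - x\<^sup>2)) (at x)"
      using has_field_derivative_integrating_factor[of K inv_central_binom_fps x] K D
        fps_conv_radius_inv_central_binom fps_shift_harm_inv_central_binom_ode
      by (simp add: K_def)
    have d1: "(L1 has_field_derivative - 1 / (1 - x)) (at x)"
      unfolding L1_def using D by (intro has_field_derivative_Ln_half)
    have d2: "(L2 has_field_derivative 1 / (1 + x)) (at x)"
      unfolding L2_def using D by (intro has_field_derivative_Ln_half)
    \<comment> \<open>The reflection \<open>y \<mapsto> 1 - y\<close> swaps the two dilogarithm
      arguments, so \<open>L1\<close> and \<open>L2\<close> reappear in the derivatives.\<close>
    have h: "1 - (1 + x) / 2 = (1 - x) / 2" "1 - (1 - x) / 2 = (1 + x) / 2"
      by (simp_all add: field_simps)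
    have d3: "((\<lambda>s. Li2 ((1 + s) / 2)) has_field_derivative (- L1 x / (1 + x))) (at x)"
    proof (rule DERIV_cong)
      show "((\<lambda>s. Li2 ((1 + s) / 2)) has_field_derivative
        (- Ln (1 - (1 + x) / 2) / ((1 + x) / 2)) * (1 / 2)) (at x)"
        using D nz by (intro DERIV_chain2[OF has_field_derivative_Li2])
          (auto intro!: derivative_eq_intros)
      have half: "a / (b / 2) * (1 / 2) = a / b" for a b :: complex by simp
      show "(- Ln (1 - (1 + x) / 2) / ((1 + x) / 2)) * (1 / 2) = - L1 x / (1 + x)"
        by (simp only: half h L1_def)
    qed
    have d4: "((\<lambda>s. Li2 ((1 - s) / 2)) has_field_derivative (L2 x / (1 - x))) (at x)"
    proof (rule DERIV_cong)
      show "((\<lambda>s. Li2 ((1 - s) / 2)) has_field_derivative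
        (- Ln (1 - (1 - x) / 2) / ((1 - x) / 2)) * (- 1 / 2)) (at x)"
        using D nz by (intro DERIV_chain2[OF has_field_derivative_Li2])
          (auto intro!: derivative_eq_intros)
      have half: "- a / (b / 2) * (- 1 / 2) = a / b" for a b :: complex by simp
      show "(- Ln (1 - (1 - x) / 2) / ((1 - x) / 2)) * (- 1 / 2) = L2 x / (1 - x)"
        by (simp only: half h L2_def)
    qed
    have d5: "((\<lambda>s. 1 + 1 / 4 * (L1 s + L2 s)) has_field_derivative
      0 + 1 / 4 * (- 1 / (1 - x) + 1 / (1 + x))) (at x)"
      by (intro DERIV_add DERIV_const DERIV_cmult d1 d2)
    note d5 = d5[unfolded add_0]
    have "(\<phi> has_field_derivative
      ((- 1 / (1 - x) - 1 / (1 + x)) * (1 + 1 / 4 * (L1 x + L2 x))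
        + 1 / 4 * (- 1 / (1 - x) + 1 / (1 + x)) * (L1 x - L2 x)
        - (- L1 x / (1 + x) - L2 x / (1 - x)) / 2)) (at x)"
      unfolding \<phi>_def by (intro DERIV_diff DERIV_cdivide DERIV_mult d1 d2 d3 d4 d5)
    also have "((- 1 / (1 - x) - 1 / (1 + x)) * (1 + 1 / 4 * (L1 x + L2 x))
        + 1 / 4 * (- 1 / (1 - x) + 1 / (1 + x)) * (L1 x - L2 x)
        - (- L1 x / (1 + x) - L2 x / (1 - x)) / 2) = - (2 + x * (L1 x - L2 x)) / (1 - x\<^sup>2)"
    proof -
      \<comment> \<open>Writing every quotient as a multiple of \<open>p\<close> makes the identity
        polynomial.\<close>
      define p where "p = 1 / (1 - x\<^sup>2)"
      have "1 / (1 - x) = p * (1 + x)" "1 / (1 + x) = p * (1 - x)"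
        unfolding p_def eq using nz by (simp_all only: divide_simps) simp_all
      moreover have "c / u = c * (1 / u)" for c u :: complex by simp
      ultimately have "c / (1 - x) = c * (p * (1 + x))" "c / (1 + x) = c * (p * (1 - x))"
        "c / (1 - x\<^sup>2) = c * p" for c
        unfolding p_def by metis+
      thus ?thesis by (simp only:) (simp add: field_simps)
    qed
    finally show "(\<phi> has_field_derivative - (2 + x * (L1 x - L2 x)) / (1 - x\<^sup>2)) (at x)" .
  qed (auto simp: \<phi>_def L1_def L2_def)
  define z where "z = s\<^sup>2 / (1 - s\<^sup>2)"
  have u: "1 - s\<^sup>2 \<noteq> 0" and z: "norm z < 1" using param_domainD[OF s] by (auto simp: z_def)
  have eq: "harm_inv_central_binom_fps = fps_X * K"
    by (rule fps_ext) (auto simp: K_def harm_inv_central_binom_fps_def fps_X_mult_nth harm_def)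
  have "ereal (norm z) < fps_conv_radius K"
    using z by (intro less_le_trans[OF _ K]) simp
  hence "eval_fps harm_inv_central_binom_fps z = z * eval_fps K z"
    unfolding eq by (simp add: eval_fps_mult)
  also have "z * eval_fps K z = s * (1 - s\<^sup>2) * (s * eval_fps K z / (1 - s\<^sup>2)\<^sup>2)"
    using u by (simp add: z_def power2_eq_square divide_simps)
  also have "s * eval_fps K z / (1 - s\<^sup>2)\<^sup>2 = \<phi> s" using * by (simp add: z_def)
  finally have "eval_fps harm_inv_central_binom_fps z = s * (1 - s\<^sup>2) * \<phi> s" .
  moreover have "s * u * (a * b - c / 2) = u * (s * a * b - s / 2 * c)" for a b c u :: complex
    by (simp add: algebra_simps)
  ultimately show ?thesis
    unfolding Ln_param_domain[OF s] z_def \<phi>_def L1_def L2_def by (simp only:)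
qed

section \<open>Arbitrary square roots\<close>

text \<open>The evaluation above holds for every parameter in \<open>param_domain\<close>, hence for
  whichever root \<open>sq\<close> selects at \<open>t\<close>.\<close>

lemma eval_fps_eq_closed_form1:
  assumes sq: "\<And>w. sq w ^ 2 = w" and z: "norm z < 1" "norm (z / (1 + z)) \<le> 1"
  shows "eval_fps harm_inv_central_binom_fps z = closed_form1 sq z"
proof -
  define t s where "t = z / (1 + z)" and "s = sq t"
  have z1: "1 + z \<noteq> 0" using z(1) by (metis add_eq_0_iff less_irrefl norm_minus_cancel norm_one)
  have st: "s\<^sup>2 = t" by (simp add: s_def sq)
  have t1: "1 - t = 1 / (1 + z)" using z1 by (simp add: t_def field_simps)
  have zt: "t / (1 - t) = z" unfolding t1 using z1 by (simp add: t_def)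
  \<comment> \<open>Now \<open>norm z < 1\<close> yields \<open>norm t < norm (1 - t)\<close>, which
    means \<open>Re t < 1 / 2\<close>.\<close>
  have "t = z * (1 - t)" unfolding t1 by (simp add: t_def)
  hence "norm t = norm z * norm (1 - t)" by (metis norm_mult)
  also have "\<dots> < 1 * norm (1 - t)" using z(1) z1 by (intro mult_strict_right_mono) (auto simp: t1)
  finally have "(norm t)\<^sup>2 < (norm (1 - t))\<^sup>2" by (intro power_strict_mono) auto
  hence "Re t < 1 / 2" unfolding cmod_power2 by (simp add: power2_eq_square algebra_simps)
  moreover have "norm s ^ 2 \<le> 1 ^ 2" using z(2) st by (simp add: t_def flip: norm_power)
  hence "norm s \<le> 1" by (rule power2_le_imp_le) simp
  ultimately have "s \<in> param_domain" using st by (simp add: param_domain_def)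
  from eval_harm_inv_central_binom_fps[OF this] show ?thesis
    unfolding st zt closed_form1_def by (simp add: Let_def t_def s_def)
qed

text \<open>The roots \<open>w\<close> and \<open>v\<close> are chosen independently, so
  \<open>\<i> * w\<close> is \<open>v\<close> or \<open>- v\<close>. The right-hand side is even in
  \<open>v\<close>, and the logarithmic definition of \<open>Arctan\<close> gives the claim for
  \<open>v = \<i> * w\<close>.\<close>

lemma Arctan_conv_Ln_sqrt:
  assumes w: "w\<^sup>2 = t" and v: "v\<^sup>2 = - t" and t: "norm t \<le> 1" "t \<noteq> - 1"
  shows "2 * (w * Arctan w) = v * Ln ((1 - v) / (1 + v))"
proof -
  define h where "h = (\<lambda>v::complex. v * Ln ((1 - v) / (1 + v)))"
  have nv: "norm v \<le> 1"
  proof -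
    have "norm v ^ 2 \<le> 1 ^ 2" using v t(1) by (simp flip: norm_power)
    thus ?thesis by (rule power2_le_imp_le) simp
  qed
  have "v\<^sup>2 \<noteq> 1" using v t(2) by (metis minus_minus)
  hence "v \<noteq> 1" "- v \<noteq> 1" by (auto, metis add.inverse_inverse power2_minus one_power2)
  hence re: "Re (1 - v) > 0" "Re (1 + v) > 0"
    using Re_less_one_if_norm_le_one[of v] Re_less_one_if_norm_le_one[of "- v"] nv by auto
  have even: "h (- v) = h v"
    unfolding h_def minus_minus diff_minus_eq_add add_uminus_conv_diff
      Ln_divide_right_half_plane[OF re] Ln_divide_right_half_plane[OF re(2,1)]
    by (simp add: algebra_simps)
  have "(\<i> * w)\<^sup>2 = v\<^sup>2" using w v by (simp add: power_mult_distrib)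
  hence "\<i> * w = v \<or> \<i> * w = - v" by (simp add: power2_eq_iff)
  hence "h (\<i> * w) = h v" using even by auto
  moreover have "2 * (w * (\<i> / 2 * x)) = \<i> * w * x" for x by simp
  ultimately show ?thesis unfolding h_def Arctan_def by (simp only:)
qed

text \<open>Replacing \<open>z\<close> by \<open>- z\<close> turns \<open>t\<close> into
  \<open>- t\<close>. The dilogarithm terms then agree verbatim and only the arctangent has to be
  rewritten.\<close>

lemma closed_form2_eq_closed_form1:
  assumes sq: "\<And>w. sq w ^ 2 = w" and z: "norm z < 1" "norm (z / (1 - z)) \<le> 1"
  shows "closed_form2 sq z = closed_form1 sq (- z)"
proof -
  define t where "t = z / (1 - z)"
  have t: "- z / (1 + - z) = - t" by (simp add: t_def)
  have z1: "1 - z \<noteq> 0" using z(1) by auto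
  hence "t \<noteq> - 1" by (auto simp: t_def field_simps)
  hence "2 * (sq t * Arctan (sq t)) = sq (- t) * Ln ((1 - sq (- t)) / (1 + sq (- t)))"
    using sq z(2) by (intro Arctan_conv_Ln_sqrt[where t = t]) (auto simp: t_def)
  moreover have "(2 + 1 / 2 * Ln ((1 + t) / 4)) * (sq t * Arctan (sq t))
    = 2 * (sq t * Arctan (sq t)) * (1 + 1 / 4 * Ln ((1 + t) / 4))" by (simp add: algebra_simps)
  ultimately show ?thesis
    unfolding closed_form2_def closed_form1_def Let_def t t_def[symmetric] by simp
qed

section \<open>Summation formulas and Taylor coefficients\<close>

lemma harm_inv_central_binom_sums:
  assumes "norm z < 1"
  shows "(\<lambda>n. inv_central_binom n * harm n * z ^ n) sums eval_fps harm_inv_central_binom_fps z"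
proof -
  have "ereal (norm z) < fps_conv_radius harm_inv_central_binom_fps"
    using assms by (intro less_le_trans[OF _ fps_conv_radius_harm_inv_central_binom]) simp
  from sums_eval_fps[OF this] show ?thesis by (simp add: harm_inv_central_binom_fps_def)
qed

lemma closed_form1_sums:
  assumes "\<And>w. sq w ^ 2 = w" "norm z < 1" "norm (z / (1 + z)) \<le> 1"
  shows "(\<lambda>n. inverse (of_nat ((2 * n) choose n)) * harm n * (-1) ^ n * 4 ^ n * z ^ n)
           sums closed_form1 sq z"
proof -
  have "(\<lambda>n. inverse (of_nat ((2 * n) choose n)) * harm n * (-1) ^ n * 4 ^ n * z ^ n)
    = (\<lambda>n. inv_central_binom n * harm n * z ^ n)"
    by (simp add: inv_central_binom_def fun_eq_iff divide_inverse mult_ac flip: power_mult_distrib)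
  thus ?thesis
    using harm_inv_central_binom_sums[OF assms(2)] eval_fps_eq_closed_form1[OF assms] by simp
qed

lemma closed_form2_sums:
  assumes "\<And>w. sq w ^ 2 = w" "norm z < 1" "norm (z / (1 - z)) \<le> 1"
  shows "(\<lambda>n. inverse (of_nat ((2 * n) choose n)) * harm n * 4 ^ n * z ^ n) sums closed_form2 sq z"
proof -
  have "norm (- z / (1 + - z)) \<le> 1" using assms(3) by (simp add: norm_divide)
  from closed_form1_sums[OF assms(1) _ this] assms(2)
  have "(\<lambda>n. inverse (of_nat ((2 * n) choose n)) * harm n * (-1) ^ n * 4 ^ n * (- z) ^ n)
          sums closed_form1 sq (- z)" by simp
  also have "(\<lambda>n. inverse (of_nat ((2 * n) choose n)) * harm n * (-1) ^ n * 4 ^ n * (- z) ^ n)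
    = (\<lambda>n. inverse (of_nat ((2 * n) choose n)) * harm n * 4 ^ n * z ^ n)"
  proof
    fix n
    have "(-1) ^ n * (- z) ^ n = z ^ n" by (simp flip: power_mult_distrib)
    moreover have "c * d * (-1) ^ n * e * y = c * d * e * ((-1) ^ n * y)" for c d e y :: complex
      by (simp only: mult_ac)
    ultimately show "inverse (of_nat ((2 * n) choose n)) * harm n * (-1) ^ n * 4 ^ n * (- z) ^ n
      = inverse (of_nat ((2 * n) choose n)) * harm n * 4 ^ n * z ^ n"
      by (simp only:)
  qed
  finally show ?thesis using closed_form2_eq_closed_form1[OF assms] by simp
qed

lemma has_fps_expansion_if_sums_near_0:
  fixes f :: "complex \<Rightarrow> complex"
  assumes "r > 0" and sums: "\<And>z. norm z < r \<Longrightarrow> (\<lambda>n. a n * z ^ n) sums f z"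
  shows "f has_fps_expansion Abs_fps a"
  unfolding has_fps_expansion_def
proof
  \<comment> \<open>Convergence at the single point \<open>r / 2\<close> already makes the radius of
    convergence positive.\<close>
  have "summable (\<lambda>n. a n * of_real (r / 2) ^ n)"
    using assms(1) sums[of "of_real (r / 2)"] by (auto simp: sums_iff)
  hence "norm (of_real (r / 2) :: complex) \<le> conv_radius a" by (rule conv_radius_geI)
  thus "0 < fps_conv_radius (Abs_fps a)"
    using assms(1) by (simp add: fps_conv_radius_def) (metis ereal_less(2) half_gt_zero less_le_trans)
  have "eventually (\<lambda>z. z \<in> ball 0 r) (nhds (0::complex))"
    using assms(1) by (intro eventually_nhds_in_open) auto
  thus "eventually (\<lambda>z. eval_fps (Abs_fps a) z = f z) (nhds 0)"
    by eventually_elim (use sums in \<open>auto simp: eval_fps_def sums_iff\<close>)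
qed

text \<open>Here \<open>norm (1 + z)\<close> and \<open>norm (1 - z)\<close> exceed 1/2. Near 0 the
  condition on \<open>t\<close> is thus automatic, so the sums hold on a full neighbourhood of
  0.\<close>

lemma norm_moebius_le_one:
  assumes "norm (z::complex) < 1 / 2"
  shows "norm (z / (1 + z)) \<le> 1" "norm (z / (1 - z)) \<le> 1"
  using assms norm_triangle_ineq2[of 1 "- z"] norm_triangle_ineq2[of 1 z]
  by (auto simp: norm_divide divide_simps)

theorem theorem1:
  fixes sq :: "complex \<Rightarrow> complex"
  assumes sq: "\<And>w. sq w ^ 2 = w"
  shows
    "(\<forall>z::complex. norm z < 1 \<longrightarrow> norm (z / (1 + z)) \<le> 1 \<longrightarrow>
        (\<lambda>n. inverse (of_nat ((2 * n) choose n)) * harm n * (-1) ^ n * 4 ^ n * z ^ n)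
          sums closed_form1 sq z)
     \<and> closed_form1 sq has_fps_expansion fps_expansion (closed_form1 sq) 0
     \<and> map (fps_nth (fps_expansion (closed_form1 sq) 0)) [0..<6]
         = [0, -2, 4, - (88 / 15), 160 / 21, - (8768 / 945)]
     \<and> (\<forall>z::complex. norm z < 1 \<longrightarrow> norm (z / (1 - z)) \<le> 1 \<longrightarrow>
        (\<lambda>n. inverse (of_nat ((2 * n) choose n)) * harm n * 4 ^ n * z ^ n)
          sums closed_form2 sq z)
     \<and> closed_form2 sq has_fps_expansion fps_expansion (closed_form2 sq) 0
     \<and> map (fps_nth (fps_expansion (closed_form2 sq) 0)) [0..<6]
         = [0, 2, 4, 88 / 15, 160 / 21, 8768 / 945]"
proof -
  define a b :: "nat \<Rightarrow> complex"
    where "a n = inverse (of_nat ((2 * n) choose n)) * harm n * (-1) ^ n * 4 ^ n"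
      and "b n = inverse (of_nat ((2 * n) choose n)) * harm n * 4 ^ n" for n
  have a: "closed_form1 sq has_fps_expansion Abs_fps a"
    using closed_form1_sums[OF sq] norm_moebius_le_one
    by (intro has_fps_expansion_if_sums_near_0[of "1 / 2"]) (auto simp: a_def)
  have b: "closed_form2 sq has_fps_expansion Abs_fps b"
    using closed_form2_sums[OF sq] norm_moebius_le_one
    by (intro has_fps_expansion_if_sums_near_0[of "1 / 2"]) (auto simp: b_def)
  \<comment> \<open>By uniqueness of power series expansions, the Taylor coefficients can be read
    off the sums.\<close>
  have ab: "fps_expansion (closed_form1 sq) 0 = Abs_fps a"
    "fps_expansion (closed_form2 sq) 0 = Abs_fps b"
    using a b by (auto intro: fps_expansion_eqI)
  have upt: "[0..<6] = [0, 1, 2, 3, 4, 5]" by (simp add: upt_rec)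
  have binom: "4 choose 2 = (6::nat)" "6 choose 3 = (20::nat)" "8 choose 4 = (70::nat)"
    "10 choose 5 = (252::nat)"
    by (simp_all add: binomial_fact' fact_numeral)
  have coeffs: "map (fps_nth (Abs_fps a)) [0..<6] = [0, -2, 4, - (88 / 15), 160 / 21, - (8768 / 945)]"
    "map (fps_nth (Abs_fps b)) [0..<6] = [0, 2, 4, 88 / 15, 160 / 21, 8768 / 945]"
    by (simp_all add: upt a_def b_def harm_expand binom)
  show ?thesis
    unfolding ab using closed_form1_sums[OF sq] closed_form2_sums[OF sq] a b coeffs by blast
qed

end
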